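(* Let $p$ be a prime with $5\mid(p-1)$, $g$ a primitive root modulo $p$, $d=5$, $k=(p-1)/5$, $e_p(x)=e^{2\pi i x/p}$, and $\eta_a=\sum_{j=0}^{k-1}e_p(g^{5j+a})$. Let $V_4(p)=\sum_{s=0}^{4}|\eta_s|^4$. Then $$\frac{1}{125}(4p+1)^2\le V_4(p)\le\frac{1}{125}\big(52p^2+48p^{3/2}+24p+1\big).$$ *)

theory Defs
  imports "HOL-Analysis.Analysis" "HOL-Number_Theory.Residue_Primitive_Roots"
begin

definition e_mod :: "nat \<Rightarrow> int \<Rightarrow> complex" where
  "e_mod p x = exp (2 * complex_of_real pi * \<i> * of_int x / of_nat p)"

text \<open>
  For \<open>d\<close> dividing \<open>p - 1\<close>, the number of summands is \<open>k = (p - 1) / d\<close>, so the division below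
  is exact in the intended use.
\<close>

definition gauss_period :: "nat \<Rightarrow> nat \<Rightarrow> nat \<Rightarrow> nat \<Rightarrow> complex" where
  "gauss_period p g d a = (\<Sum>j<(p - 1) div d. e_mod p (int (g ^ (d * j + a))))"

text \<open>
  The moment does not depend on the choice of primitive root, but its definition
  does refer to one, so \<open>g\<close> is kept as an argument.
\<close>

definition period_moment4 :: "nat \<Rightarrow> nat \<Rightarrow> nat \<Rightarrow> real" where
  "period_moment4 p g d = (\<Sum>s<d. cmod (gauss_period p g d s) ^ 4)"

end

(* The discrete Fourier transform of the periods eta_s over Z/5 consists of -1 and of Gauss sums
   G_1, ..., G_4 of absolute value sqrt p. Parseval evaluates the second moment as (4 p + 1) / 5,
   and Cauchy-Schwarz gives the lower bound. Expanding the fourth moment over quadruples of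
   frequencies with i + j = k + l in Z/5, the triangle inequality gives the upper bound: there
   are 52, 48, 24, 0, 1 such quadruples with respectively 0, 1, 2, 3, 4 vanishing entries. *)

theory Submission
  imports Defs
begin

section \<open>Additive characters modulo \<open>n\<close> and their orthogonality\<close>

lemma e_mod_add: "e_mod n (x + y) = e_mod n x * e_mod n y"
  by (simp add: e_mod_def exp_add [symmetric] add_divide_distrib distrib_left)

lemma e_mod_0 [simp]: "e_mod n 0 = 1"
  by (simp add: e_mod_def)

lemma cnj_e_mod: "cnj (e_mod n x) = e_mod n (- x)"
  by (simp add: e_mod_def exp_cnj)

lemma e_mod_eq_exp_i: "e_mod n x = exp (\<i> * complex_of_real (2 * pi * of_int x / of_nat n))"
  by (simp add: e_mod_def mult_ac)

lemma norm_e_mod [simp]: "norm (e_mod n x) = 1"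
  unfolding e_mod_eq_exp_i by (rule norm_exp_i_times)

lemma e_mod_power: "e_mod n x ^ k = e_mod n (x * int k)"
  by (induction k) (simp_all add: e_mod_add algebra_simps)

lemma e_mod_eq_1_iff:
  assumes "n > 0"
  shows "e_mod n x = 1 \<longleftrightarrow> int n dvd x"
proof -
  have "e_mod n x = 1 \<longleftrightarrow> (\<exists>k::int. 2 * pi * of_int x / real n = of_int (2 * k) * pi)"
    unfolding e_mod_eq_exp_i by (simp add: exp_eq_1)
  also have "\<dots> \<longleftrightarrow> (\<exists>k::int. x = int n * k)"
  proof (rule ex_cong1)
    fix k :: int
    have "2 * pi * of_int x / real n = of_int (2 * k) * pi \<longleftrightarrow> real_of_int x = of_int (int n * k)"
      using assms by (simp add: field_simps)
    then show "2 * pi * of_int x / real n = of_int (2 * k) * pi \<longleftrightarrow> x = int n * k"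
      by (simp only: of_int_eq_iff)
  qed
  finally show ?thesis
    by (simp add: dvd_def)
qed

lemma e_mod_cong:
  assumes "n > 0" "[x = y] (mod int n)"
  shows "e_mod n x = e_mod n y"
proof -
  have "int n dvd x - y"
    using assms(2) by (simp add: cong_iff_dvd_diff)
  then have "e_mod n (x - y) = 1"
    using e_mod_eq_1_iff [OF assms(1)] by simp
  then show ?thesis
    using e_mod_add [of n "x - y" y] by simp
qed

text \<open>The summands are powers of \<open>e_mod n a\<close>, an \<open>n\<close>-th root of
  unity, so unless that root is 1 the geometric sum vanishes.\<close>

lemma sum_e_mod:
  assumes "n > 0"
  shows "(\<Sum>x<n. e_mod n (a * int x)) = (if int n dvd a then of_nat n else 0)"
proof (cases "int n dvd a")
  case True
  then have "e_mod n (a * int x) = 1" for x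
    using e_mod_eq_1_iff [OF assms] by simp
  then show ?thesis
    using True by simp
next
  case False
  then have "e_mod n a \<noteq> 1"
    using e_mod_eq_1_iff [OF assms] by simp
  moreover have "e_mod n a ^ n = 1"
    using e_mod_eq_1_iff [OF assms] by (simp add: e_mod_power)
  ultimately show ?thesis
    using False by (simp add: e_mod_power [symmetric] geometric_sum)
qed

text \<open>The powers of \<open>g\<close> run once through the nonzero residues, so this is the
  complete sum over \<open>x < p\<close> less its term 1 at \<open>x = 0\<close>.\<close>

lemma sum_e_mod_primroot:
  assumes "prime p" "residue_primroot p g"
  shows "(\<Sum>v<p - 1. e_mod p (a * int (g ^ v))) = (if int p dvd a then of_nat p else 0) - 1"
proof -
  have p: "p > 1"
    using assms(1) by (rule prime_gt_1_nat)
  have "bij_betw (\<lambda>i. g ^ i mod p) {..<p - 1} {0<..<p}"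
    using residue_primroot_is_generator [OF p assms(2)] assms(1)
    by (simp add: totient_prime totatives_prime)
  then have "(\<Sum>v<p - 1. e_mod p (a * int (g ^ v mod p))) = (\<Sum>x\<in>{0<..<p}. e_mod p (a * int x))"
    by (rule sum.reindex_bij_betw)
  moreover have "e_mod p (a * int (g ^ v mod p)) = e_mod p (a * int (g ^ v))" for v
    using p by (intro e_mod_cong cong_scalar_left) (simp_all add: cong_def zmod_int)
  moreover have "{..<p} = insert 0 {0<..<p}"
    using p by auto
  ultimately show ?thesis
    using sum_e_mod [of p a] p by (auto simp: algebra_simps)
qed

lemma int_dvd_diff_iff_eq:
  assumes "i < d" "j < d"
  shows "int d dvd int i - int j \<longleftrightarrow> i = j"
  unfolding cong_iff_dvd_diff [symmetric] cong_int_iff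
  using assms by (auto intro: cong_less_modulus_unique_nat)

section \<open>Absolute value of Gauss sums\<close>

text \<open>Moving the window by one step trades \<open>f v\<close> for the equal value
  \<open>f (v + n)\<close>. This allows the substitution \<open>u = v + w\<close> in the squared
  Gauss sum.\<close>

lemma sum_periodic_shift:
  fixes f :: "nat \<Rightarrow> 'a::ab_group_add"
  assumes "\<And>u. f (u + n) = f u"
  shows "(\<Sum>w<n. f (v + w)) = (\<Sum>w<n. f w)"
proof (induction v)
  case (Suc v)
  have "(\<Sum>w<n. f (Suc v + w)) = (\<Sum>w<Suc n. f (v + w)) - f v"
    by (simp only: sum.lessThan_Suc_shift) simp
  also have "\<dots> = (\<Sum>w<n. f (v + w))"
    using assms [of v] by simp
  finally show ?case
    using Suc by simp
qed simp

text \<open>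
  Here \<open>\<omega>\<close> is the value at \<open>g\<close> of a nontrivial multiplicative character modulo \<open>p\<close>.
\<close>

lemma norm_gauss_sum:
  assumes p: "prime p" and g: "residue_primroot p g"
    and root: "\<omega> ^ (p - 1) = 1" and nontriv: "\<omega> \<noteq> 1" and norm: "norm \<omega> = 1"
  shows "norm (\<Sum>u<p - 1. \<omega> ^ u * e_mod p (int (g ^ u))) = sqrt (real p)"
proof -
  define n where "n = p - 1"
  define f where "f u = \<omega> ^ u * e_mod p (int (g ^ u))" for u
  have p1: "p > 1"
    using p by (rule prime_gt_1_nat)
  have "n > 0"
    using p1 by (simp add: n_def)
  have ord: "ord p g = n"
    using g p by (simp add: residue_primroot_def totient_prime n_def)
  have cong_iff: "[g ^ w = 1] (mod p) \<longleftrightarrow> n dvd w" for w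
    using ord_divides [of g w p] ord by simp
  \<comment> \<open>Both factors have period \<open>n\<close>: \<open>g\<close> has order
    \<open>n\<close> modulo \<open>p\<close>, and \<omega> is an \<open>n\<close>-th root of
    unity.\<close>
  have f_periodic: "f (u + n) = f u" for u
  proof -
    have "[g ^ u * g ^ n = g ^ u * 1] (mod p)"
      by (rule cong_scalar_left) (simp only: cong_iff dvd_refl)
    then have "[int (g ^ (u + n)) = int (g ^ u)] (mod int p)"
      by (simp only: cong_int_iff power_add mult_1_right)
    then have "e_mod p (int (g ^ (u + n))) = e_mod p (int (g ^ u))"
      using p1 by (intro e_mod_cong) auto
    then show ?thesis
      using root by (simp add: f_def power_add n_def)
  qed
  have unit: "\<omega> ^ v * cnj (\<omega> ^ v) = 1" for v
    unfolding complex_norm_square [symmetric] norm_power norm by simp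
  \<comment> \<open>In the product the character value depends on \<open>w\<close> alone, so for
    fixed \<open>w\<close> the sum over \<open>v\<close> is purely additive.\<close>
  have shift: "f (v + w) * cnj (f v) = \<omega> ^ w * e_mod p ((int (g ^ w) - 1) * int (g ^ v))" for v w
  proof -
    have "f (v + w) * cnj (f v) = (\<omega> ^ v * cnj (\<omega> ^ v)) * \<omega> ^ w
        * (e_mod p (int (g ^ (v + w))) * e_mod p (- int (g ^ v)))"
      by (simp add: f_def power_add cnj_e_mod mult_ac)
    also have "e_mod p (int (g ^ (v + w))) * e_mod p (- int (g ^ v))
        = e_mod p ((int (g ^ w) - 1) * int (g ^ v))"
      by (simp add: e_mod_add [symmetric] power_add algebra_simps)
    finally show ?thesis
      using unit by simp
  qed
  have dvd_iff: "int p dvd int (g ^ w) - 1 \<longleftrightarrow> w = 0" if "w < n" for w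
  proof -
    have "int p dvd int (g ^ w) - 1 \<longleftrightarrow> [int (g ^ w) = int 1] (mod int p)"
      by (simp add: cong_iff_dvd_diff)
    also have "\<dots> \<longleftrightarrow> n dvd w"
      by (simp only: cong_int_iff cong_iff)
    finally show ?thesis
      using that by (auto dest: dvd_imp_le)
  qed
  have "complex_of_real ((norm (sum f {..<n}))\<^sup>2) = sum f {..<n} * cnj (sum f {..<n})"
    by (rule complex_norm_square)
  also have "\<dots> = (\<Sum>v<n. (\<Sum>u<n. f u) * cnj (f v))"
    by (simp add: sum_distrib_left)
  also have "\<dots> = (\<Sum>v<n. (\<Sum>w<n. f (v + w)) * cnj (f v))"
    using sum_periodic_shift [of f n] f_periodic by simp
  also have "\<dots> = (\<Sum>v<n. \<Sum>w<n. \<omega> ^ w * e_mod p ((int (g ^ w) - 1) * int (g ^ v)))"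
    by (simp add: sum_distrib_right shift)
  also have "\<dots> = (\<Sum>w<n. \<omega> ^ w * (\<Sum>v<n. e_mod p ((int (g ^ w) - 1) * int (g ^ v))))"
    by (subst sum.swap) (simp add: sum_distrib_left)
  \<comment> \<open>The coefficient \<open>int (g ^ w) - 1\<close> is divisible by \<open>p\<close>
    only for \<open>w = 0\<close>; the inner sum is then \<open>p - 1\<close>, and otherwise
    -1.\<close>
  also have "\<dots> = (\<Sum>w<n. \<omega> ^ w * ((if w = 0 then of_nat p else 0) - 1))"
    unfolding n_def
    by (intro sum.cong refl)
      (simp only: sum_e_mod_primroot [OF p g] dvd_iff [unfolded n_def] lessThan_iff)
  also have "\<dots> = (\<Sum>w<n. if w = 0 then of_nat p else 0) - (\<Sum>w<n. \<omega> ^ w)"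
    unfolding sum_subtractf [symmetric] by (intro sum.cong refl) auto
  \<comment> \<open>The full sum of powers of \<omega> vanishes, since \<omega> is an
    \<open>n\<close>-th root of unity other than 1.\<close>
  also have "\<dots> = of_nat p"
    using root nontriv \<open>n > 0\<close> by (simp add: geometric_sum n_def)
  finally have "(norm (sum f {..<n}))\<^sup>2 = real p"
    by (metis of_real_of_nat_eq of_real_eq_iff)
  then show ?thesis
    unfolding f_def n_def by (metis norm_ge_zero real_sqrt_unique)
qed

section \<open>Fourier transform of the Gaussian periods\<close>

text \<open>The transform is not normalised, so the factor \<open>d\<close> appears on inversion,
  where the exponents change sign.\<close>

definition period_dft :: "nat \<Rightarrow> nat \<Rightarrow> nat \<Rightarrow> nat \<Rightarrow> complex" where
  "period_dft p g d m = (\<Sum>s<d. e_mod d (int (m * s)) * gauss_period p g d s)"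

text \<open>Every \<open>u < p - 1\<close> is uniquely \<open>d * j + s\<close> with
  \<open>s < d\<close>, and the \<open>d\<close>-th root of unity \<open>e_mod d (int m)\<close>
  raised to \<open>u\<close> sees only \<open>s\<close>. Hence the double sum over \<open>s\<close>
  and \<open>j\<close> merges into a single Gauss sum.\<close>

lemma period_dft_eq_gauss_sum:
  assumes "d > 0" "d dvd p - 1"
  shows "period_dft p g d m = (\<Sum>u<p - 1. e_mod d (int m) ^ u * e_mod p (int (g ^ u)))"
proof -
  define k where "k = (p - 1) div d"
  have pk: "p - 1 = k * d"
    using assms by (simp add: k_def)
  have char: "e_mod d (int m) ^ (d * j + s) = e_mod d (int (m * s))" for j s
    unfolding e_mod_power
    by (rule e_mod_cong [OF assms(1)]) (simp add: cong_iff_dvd_diff algebra_simps)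
  have "period_dft p g d m
      = (\<Sum>j<k. \<Sum>s<d. e_mod d (int m) ^ (d * j + s) * e_mod p (int (g ^ (d * j + s))))"
    unfolding period_dft_def gauss_period_def sum_distrib_left char k_def [symmetric]
    by (rule sum.swap)
  also have "\<dots> = (\<Sum>j<k. \<Sum>u\<in>{j * d..<j * d + d}.
      e_mod d (int m) ^ u * e_mod p (int (g ^ u)))"
  proof (rule sum.cong [OF refl])
    fix j
    show "(\<Sum>s<d. e_mod d (int m) ^ (d * j + s) * e_mod p (int (g ^ (d * j + s))))
        = (\<Sum>u\<in>{j * d..<j * d + d}. e_mod d (int m) ^ u * e_mod p (int (g ^ u)))"
      by (rule sum.reindex_bij_witness [of _ "\<lambda>u. u - d * j" "\<lambda>s. d * j + s"])
        (auto simp: mult.commute)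
  qed
  also have "\<dots> = (\<Sum>u<k * d. e_mod d (int m) ^ u * e_mod p (int (g ^ u)))"
    by (rule sum.nat_group)
  finally show ?thesis
    by (simp only: pk)
qed

text \<open>For \<open>m = 0\<close> the character is trivial and the sum is -1. Otherwise
  \<open>e_mod d (int m)\<close> is a \<open>d\<close>-th root of unity other than 1, and
  \<open>d\<close> divides \<open>p - 1\<close>, so \<open>norm_gauss_sum\<close> applies.\<close>

lemma norm_period_dft:
  assumes "prime p" "residue_primroot p g" "d dvd p - 1" "m < d"
  shows "norm (period_dft p g d m) = (if m = 0 then 1 else sqrt (real p))"
proof -
  have d: "d > 0"
    using assms(4) by simp
  have p1: "p > 1"
    using assms(1) by (rule prime_gt_1_nat)
  show ?thesis
  proof (cases "m = 0")
    case True
    then show ?thesis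
      using sum_e_mod_primroot [OF assms(1,2), of 1] p1
      by (simp add: period_dft_eq_gauss_sum [OF d assms(3)])
  next
    case False
    have "e_mod d (int m) ^ (p - 1) = 1"
      unfolding e_mod_power e_mod_eq_1_iff [OF d] using assms(3) by simp
    moreover have "e_mod d (int m) \<noteq> 1"
      unfolding e_mod_eq_1_iff [OF d] using False assms(4) by (auto dest: dvd_imp_le)
    ultimately show ?thesis
      using False norm_gauss_sum [OF assms(1,2)]
      by (simp add: period_dft_eq_gauss_sum [OF d assms(3)])
  qed
qed

text \<open>Fourier inversion: after exchanging the sums, orthogonality over \<open>m\<close> keeps
  only \<open>t = s\<close>.\<close>

lemma gauss_period_eq_inverse_dft:
  assumes "s < d"
  shows "of_nat d * gauss_period p g d s
    = (\<Sum>m<d. period_dft p g d m * e_mod d (- int (m * s)))"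
proof -
  have d: "d > 0"
    using assms by simp
  have dvd_iff: "int d dvd int t - int s \<longleftrightarrow> t = s" if "t < d" for t
    using that assms by (rule int_dvd_diff_iff_eq)
  have "(\<Sum>m<d. period_dft p g d m * e_mod d (- int (m * s)))
      = (\<Sum>m<d. \<Sum>t<d. gauss_period p g d t * e_mod d ((int t - int s) * int m))"
    unfolding period_dft_def sum_distrib_right
    by (intro sum.cong refl) (simp add: e_mod_add algebra_simps flip: e_mod_add)
  also have "\<dots> = (\<Sum>t<d. gauss_period p g d t * (\<Sum>m<d. e_mod d ((int t - int s) * int m)))"
    by (subst sum.swap) (simp add: sum_distrib_left)
  also have "\<dots> = (\<Sum>t<d. if t = s then gauss_period p g d t * of_nat d else 0)"
    using dvd_iff by (intro sum.cong refl) (simp add: sum_e_mod [OF d])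
  also have "\<dots> = of_nat d * gauss_period p g d s"
    using assms by simp
  finally show ?thesis ..
qed

section \<open>Moments of a finite Fourier transform\<close>

text \<open>Parseval: in the expanded square, orthogonality over \<open>s\<close> leaves only the
  diagonal \<open>i = j\<close>.\<close>

lemma second_moment_dft:
  fixes a :: "nat \<Rightarrow> complex"
  assumes "d > 0"
  shows "(\<Sum>s<d. norm (\<Sum>m<d. a m * e_mod d (- int (m * s))) ^ 2) = d * (\<Sum>m<d. norm (a m) ^ 2)"
proof -
  have "complex_of_real (\<Sum>s<d. norm (\<Sum>m<d. a m * e_mod d (- int (m * s))) ^ 2)
      = (\<Sum>s<d. \<Sum>i<d. \<Sum>j<d. a i * cnj (a j) * e_mod d ((int j - int i) * int s))"
    unfolding of_real_sum complex_norm_square cnj_sum sum_product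
    by (intro sum.cong refl) (simp add: cnj_e_mod algebra_simps flip: e_mod_add)
  also have "\<dots> = (\<Sum>i<d. \<Sum>s<d. \<Sum>j<d. a i * cnj (a j) * e_mod d ((int j - int i) * int s))"
    by (rule sum.swap)
  also have "\<dots> = (\<Sum>i<d. \<Sum>j<d. \<Sum>s<d. a i * cnj (a j) * e_mod d ((int j - int i) * int s))"
    by (rule sum.cong [OF refl], rule sum.swap)
  also have "\<dots> = (\<Sum>i<d. \<Sum>j<d. if j = i then a i * cnj (a j) * of_nat d else 0)"
    by (intro sum.cong refl)
      (simp add: sum_distrib_left [symmetric] sum_e_mod [OF assms] int_dvd_diff_iff_eq)
  also have "\<dots> = complex_of_real (d * (\<Sum>m<d. norm (a m) ^ 2))"
    by (simp add: complex_norm_square sum_distrib_left mult_ac del: of_real_power)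
  finally show ?thesis
    by (simp only: of_real_eq_iff)
qed

text \<open>Expanding two factors and two conjugates, orthogonality over \<open>s\<close> retains
  the quadruples with \<open>i + j\<close> congruent to \<open>k + l\<close> modulo
  \<open>d\<close>. Only the absolute values of the coefficients enter the bound, so the phases are
  discarded by the triangle inequality.\<close>

lemma fourth_moment_dft_le:
  fixes a :: "nat \<Rightarrow> complex"
  assumes "d > 0"
  shows "(\<Sum>s<d. norm (\<Sum>m<d. a m * e_mod d (- int (m * s))) ^ 4)
    \<le> d * (\<Sum>i<d. \<Sum>j<d. \<Sum>k<d. \<Sum>l<d. if int d dvd int k + int l - int i - int j
          then norm (a i) * norm (a j) * norm (a k) * norm (a l) else 0)"
proof -
  define f where "f s = (\<Sum>m<d. a m * e_mod d (- int (m * s)))" for s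
  define c where "c i j k l = a i * a j * cnj (a k) * cnj (a l)" for i j k l
  define r where "r i j k l = int k + int l - int i - int j" for i j k l :: nat
  have "complex_of_real (norm (f s) ^ 4)
      = (\<Sum>i<d. \<Sum>j<d. \<Sum>k<d. \<Sum>l<d. c i j k l * e_mod d (r i j k l * int s))" for s
  proof -
    have "complex_of_real (norm (f s) ^ 4) = complex_of_real (norm (f s * f s) ^ 2)"
      by (simp add: norm_mult power2_eq_square power4_eq_xxxx)
    also have "\<dots> = (f s * f s) * (cnj (f s) * cnj (f s))"
      unfolding complex_norm_square by simp
    also have "\<dots> = f s * (f s * (cnj (f s) * cnj (f s)))"
      by (simp add: mult_ac)
    also have "\<dots> = (\<Sum>i<d. \<Sum>j<d. \<Sum>k<d. \<Sum>l<d.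
        (a i * e_mod d (- int (i * s))) * ((a j * e_mod d (- int (j * s)))
          * (cnj (a k * e_mod d (- int (k * s))) * cnj (a l * e_mod d (- int (l * s))))))"
      unfolding f_def cnj_sum sum_product by (simp only: sum_distrib_left)
    also have "\<dots> = (\<Sum>i<d. \<Sum>j<d. \<Sum>k<d. \<Sum>l<d. c i j k l * e_mod d (r i j k l * int s))"
      by (intro sum.cong refl)
        (simp add: c_def r_def cnj_e_mod algebra_simps flip: e_mod_add)
    finally show ?thesis .
  qed
  then have "complex_of_real (\<Sum>s<d. norm (f s) ^ 4)
      = (\<Sum>s<d. \<Sum>i<d. \<Sum>j<d. \<Sum>k<d. \<Sum>l<d. c i j k l * e_mod d (r i j k l * int s))"
    by simp
  \<comment> \<open>The sum over \<open>s\<close> is moved inwards past one index at a time, until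
    orthogonality applies to it.\<close>
  also have "\<dots> = (\<Sum>i<d. \<Sum>s<d. \<Sum>j<d. \<Sum>k<d. \<Sum>l<d. c i j k l * e_mod d (r i j k l * int s))"
    by (rule sum.swap)
  also have "\<dots> = (\<Sum>i<d. \<Sum>j<d. \<Sum>s<d. \<Sum>k<d. \<Sum>l<d. c i j k l * e_mod d (r i j k l * int s))"
    by (rule sum.cong [OF refl], rule sum.swap)
  also have "\<dots> = (\<Sum>i<d. \<Sum>j<d. \<Sum>k<d. \<Sum>s<d. \<Sum>l<d. c i j k l * e_mod d (r i j k l * int s))"
    by (rule sum.cong [OF refl], rule sum.cong [OF refl], rule sum.swap)
  also have "\<dots> = (\<Sum>i<d. \<Sum>j<d. \<Sum>k<d. \<Sum>l<d. \<Sum>s<d. c i j k l * e_mod d (r i j k l * int s))"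
    by (rule sum.cong [OF refl], rule sum.cong [OF refl], rule sum.cong [OF refl], rule sum.swap)
  also have "\<dots> = (\<Sum>i<d. \<Sum>j<d. \<Sum>k<d. \<Sum>l<d.
      c i j k l * (if int d dvd r i j k l then of_nat d else 0))"
    by (simp only: sum_distrib_left [symmetric] sum_e_mod [OF assms])
  finally have eq: "complex_of_real (\<Sum>s<d. norm (f s) ^ 4) = \<dots>" .
  \<comment> \<open>The moment is a nonnegative real, hence equal to its own norm, which opens the
    way to the triangle inequality for the complex sum.\<close>
  have "(\<Sum>s<d. norm (f s) ^ 4) = norm (complex_of_real (\<Sum>s<d. norm (f s) ^ 4))"
    by (simp only: norm_of_real) (simp add: sum_nonneg)
  also have "\<dots> \<le> (\<Sum>i<d. \<Sum>j<d. \<Sum>k<d. \<Sum>l<d.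
      norm (c i j k l) * (if int d dvd r i j k l then real d else 0))"
    unfolding eq by (intro sum_norm_le) (simp add: norm_mult)
  also have "\<dots> = d * (\<Sum>i<d. \<Sum>j<d. \<Sum>k<d. \<Sum>l<d. if int d dvd r i j k l
          then norm (a i) * norm (a j) * norm (a k) * norm (a l) else 0)"
    unfolding sum_distrib_left by (intro sum.cong refl) (simp add: c_def norm_mult)
  finally show ?thesis
    unfolding f_def r_def .
qed

section \<open>Bounds for the fourth moment of the quintic periods\<close>

theorem theorem3p4:
  fixes p g :: nat
  assumes "prime p"
    and "5 dvd p - 1"
    and "residue_primroot p g"
  shows "1 / 125 * (4 * real p + 1) ^ 2 \<le> period_moment4 p g 5
    \<and> period_moment4 p g 5
        \<le> 1 / 125 * (52 * real p ^ 2 + 48 * real p powr (3 / 2) + 24 * real p + 1)"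
proof
  \<comment> \<open>With \<open>q\<close> in place of the square root, every product of four
    coefficient norms is a monomial in \<open>q\<close>.\<close>
  define q where "q = sqrt (real p)"
  define f where "f s = (\<Sum>m<5. period_dft p g 5 m * e_mod 5 (- int (m * s)))" for s
  have q2: "q ^ 2 = real p" and q0: "q \<ge> 0"
    by (simp_all add: q_def)
  have norm_dft: "norm (period_dft p g 5 m) = (if m = 0 then 1 else q)" if "m < 5" for m
    using norm_period_dft [OF assms(1,3,2) that] by (simp add: q_def)
  have norm_period: "norm (gauss_period p g 5 s) = norm (f s) / 5" if "s < 5" for s
  proof -
    have "norm (of_nat 5 * gauss_period p g 5 s) = norm (f s)"
      unfolding f_def by (simp only: gauss_period_eq_inverse_dft [OF that])
    then show ?thesis
      by (simp add: norm_mult)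
  qed
  \<comment> \<open>Inversion gives each period a factor 1/5, whence 625 = 5^4.\<close>
  have moment: "period_moment4 p g 5 = (\<Sum>s<5. norm (f s) ^ 4) / 625"
    by (simp add: period_moment4_def norm_period power_divide sum_divide_distrib)

  have "(\<Sum>s<5. norm (f s) ^ 2) = 5 * (\<Sum>m<5. norm (period_dft p g 5 m) ^ 2)"
    unfolding f_def using second_moment_dft [of 5 "period_dft p g 5"] by simp
  also have "\<dots> = 5 * (4 * real p + 1)"
    by (simp add: norm_dft lessThan_nat_numeral lessThan_Suc q2)
  finally have second: "(\<Sum>s<5. norm (f s) ^ 2) = 5 * (4 * real p + 1)" .
  \<comment> \<open>Cauchy-Schwarz against the constant 1 on five points; 25 / (5 * 625) gives the
    factor 1/125.\<close>
  have "(\<Sum>s<5. norm (f s) ^ 2 * 1)\<^sup>2 \<le> (\<Sum>s<5. (norm (f s) ^ 2)\<^sup>2) * (\<Sum>s<5::nat. 1\<^sup>2)"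
    by (rule Cauchy_Schwarz_ineq_sum)
  then have "(5 * (4 * real p + 1))\<^sup>2 \<le> (\<Sum>s<5. norm (f s) ^ 4) * 5"
    by (simp add: second)
  then show "1 / 125 * (4 * real p + 1) ^ 2 \<le> period_moment4 p g 5"
    unfolding moment power_mult_distrib by simp

  have "(\<Sum>s<5. norm (f s) ^ 4)
      \<le> 5 * (\<Sum>i<5. \<Sum>j<5. \<Sum>k<5. \<Sum>l<5. if 5 dvd int k + int l - int i - int j
          then norm (period_dft p g 5 i) * norm (period_dft p g 5 j)
            * norm (period_dft p g 5 k) * norm (period_dft p g 5 l) else 0)"
    unfolding f_def using fourth_moment_dft_le [of 5 "period_dft p g 5"] by simp
  \<comment> \<open>All quadruples are enumerated; 125 of them satisfy the congruence. Three zero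
    entries force the fourth to be zero, so no term linear in \<open>q\<close> occurs.\<close>
  also have "\<dots> = 5 * (52 * q ^ 4 + 48 * q ^ 3 + 24 * q ^ 2 + 1)"
    by (simp add: norm_dft lessThan_nat_numeral lessThan_Suc power4_eq_xxxx power3_eq_cube
        power2_eq_square algebra_simps)
  also have "q ^ 4 = real p ^ 2"
    using q2 by (simp add: power4_eq_xxxx power2_eq_square)
  also have "q ^ 3 = real p powr (3 / 2)"
  proof -
    have "real p > 0"
      using prime_gt_0_nat [OF assms(1)] by simp
    then have "q ^ 3 = (real p powr (1 / 2)) powr 3"
      by (simp add: q_def powr_half_sqrt)
    then show ?thesis
      by (simp only: powr_powr) simp
  qed
  finally show "period_moment4 p g 5
      \<le> 1 / 125 * (52 * real p ^ 2 + 48 * real p powr (3 / 2) + 24 * real p + 1)"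
    unfolding moment q2 by simp
qed

end
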